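(* Let $\operatorname{pn}_\ell(K_n)$ and $\operatorname{pn}_u(K_n)$ denote the local page number and the union page number of the complete graph $K_n$ on $n$ vertices. Then $$\frac{1}{3}n \pm \mathcal{O}(1) = \operatorname{pn}_\ell(K_n) \leq \operatorname{pn}_u(K_n) \leq \frac{4}{9}n + \mathcal{O}(1),$$ that is, there is an absolute constant $c$ such that for every integer $n \geq 1$ we have $\bigl|\operatorname{pn}_\ell(K_n) - \tfrac{n}{3}\bigr| \leq c$ and $\operatorname{pn}_\ell(K_n) \leq \operatorname{pn}_u(K_n) \leq \tfrac{4}{9}n + c$.
   Context: All graphs are finite and simple. A linear layout of a graph $G$ consists of a total ordering $\prec$ of $V(G)$ together with a partition of $E(G)$. For a fixed vertex ordering $\prec$, two independent edges (edges with no common endpoint) $vw$ and $xy$ with $v \prec w$ and $x \prec y$ cross if $v \prec x \prec w \prec y$ or $x \prec v \prec y \prec w$. A page (with respect to $\prec$) is a set of edges that are pairwise non-crossing. A union page (with respect to $\prec$) is a vertex-disjoint union of pages, i.e. a set of edges that is a union of pages no two of which contain edges incident to a common vertex. A book embedding is a linear layout in which every part of the edge partition is a page. It is $k$-local if each vertex has incident edges in at most $k$ parts of the partition. The local page number $\operatorname{pn}_\ell(G)$ is the smallest $k$ such that $G$ has a $k$-local book embedding (for some vertex ordering; the total number of pages is unrestricted). The union page number $\operatorname{pn}_u(G)$ is the smallest $k$ such that there are a vertex ordering of $G$ and a partition of $E(G)$ into at most $k$ union pages. *)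

theory Defs
  imports Complex_Main "HOL-Library.Disjoint_Sets" "HOL-Library.Ramsey"
begin

text \<open>
  A graph is a pair of a vertex set and a set of edges, an edge being a two-element set of
  vertices. All notions below are meant for finite simple graphs; in particular cardinalities
  of sets of edges or of parts of an edge partition are then cardinalities of finite sets.
\<close>

type_synonym 'a graph = "'a set \<times> 'a set set"

abbreviation verts :: "'a graph \<Rightarrow> 'a set" where
  "verts G \<equiv> fst G"

abbreviation edges :: "'a graph \<Rightarrow> 'a set set" where
  "edges G \<equiv> snd G"

definition finite_simple_graph :: "'a graph \<Rightarrow> bool" where
  "finite_simple_graph G \<longleftrightarrow> finite (verts G) \<and> edges G \<subseteq> nsets (verts G) 2"

definition complete_graph :: "nat \<Rightarrow> nat graph" where
  "complete_graph n = ({..<n}, nsets {..<n} 2)"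

definition vertex_ordering :: "'a graph \<Rightarrow> 'a rel \<Rightarrow> bool" where
  "vertex_ordering G r \<longleftrightarrow> r \<subseteq> verts G \<times> verts G \<and> strict_linear_order_on (verts G) r"

definition linear_layout :: "'a graph \<Rightarrow> 'a rel \<Rightarrow> 'a set set set \<Rightarrow> bool" where
  "linear_layout G r P \<longleftrightarrow> vertex_ordering G r \<and> partition_on (edges G) P"

definition incident_edges :: "'a \<Rightarrow> 'a set set \<Rightarrow> 'a set set" where
  "incident_edges v F = {e \<in> F. v \<in> e}"

definition crossing :: "'a rel \<Rightarrow> 'a set \<Rightarrow> 'a set \<Rightarrow> bool" where
  "crossing r e f \<longleftrightarrow> e \<inter> f = {} \<and>
     (\<exists>v w x y. e = {v, w} \<and> f = {x, y} \<and> (v, w) \<in> r \<and> (x, y) \<in> r \<and>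
        ((v, x) \<in> r \<and> (x, w) \<in> r \<and> (w, y) \<in> r \<or>
         (x, v) \<in> r \<and> (v, y) \<in> r \<and> (y, w) \<in> r))"

definition page :: "'a rel \<Rightarrow> 'a set set \<Rightarrow> bool" where
  "page r F \<longleftrightarrow> (\<forall>e\<in>F. \<forall>f\<in>F. \<not> crossing r e f)"

definition union_page :: "'a rel \<Rightarrow> 'a set set \<Rightarrow> bool" where
  "union_page r F \<longleftrightarrow>
     (\<exists>Q. F = \<Union>Q \<and> (\<forall>A\<in>Q. page r A) \<and>
        (\<forall>A\<in>Q. \<forall>B\<in>Q. A \<noteq> B \<longrightarrow>
           \<not> (\<exists>v. incident_edges v A \<noteq> {} \<and> incident_edges v B \<noteq> {})))"

definition book_embedding :: "'a graph \<Rightarrow> 'a rel \<Rightarrow> 'a set set set \<Rightarrow> bool" where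
  "book_embedding G r P \<longleftrightarrow> linear_layout G r P \<and> (\<forall>A\<in>P. page r A)"

definition k_local :: "nat \<Rightarrow> 'a graph \<Rightarrow> 'a set set set \<Rightarrow> bool" where
  "k_local k G P \<longleftrightarrow> (\<forall>v\<in>verts G. card {A \<in> P. incident_edges v A \<noteq> {}} \<le> k)"

definition local_page_number :: "'a graph \<Rightarrow> nat" where
  "local_page_number G = (LEAST k. \<exists>r P. book_embedding G r P \<and> k_local k G P)"

definition union_page_number :: "'a graph \<Rightarrow> nat" where
  "union_page_number G =
     (LEAST k. \<exists>r P. linear_layout G r P \<and> (\<forall>U\<in>P. union_page r U) \<and> card P \<le> k)"

text \<open>Sanity checks: the sets over which the minima are taken are nonempty.\<close>

lemma finite_simple_graph_complete_graph: "finite_simple_graph (complete_graph n)"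
  by (simp add: finite_simple_graph_def complete_graph_def)

lemma not_crossing_self: "\<not> crossing r e e"
  unfolding crossing_def by blast

lemma ex_vertex_ordering:
  assumes "finite_simple_graph G"
  shows "\<exists>r. vertex_ordering G r"
proof -
  have fin: "finite (verts G)"
    using assms by (simp add: finite_simple_graph_def)
  obtain f :: "'a \<Rightarrow> nat" where f: "inj_on f (verts G)"
    using finite_imp_inj_to_nat_seg[OF fin] by metis
  let ?r = "{(x, y). x \<in> verts G \<and> y \<in> verts G \<and> f x < f y}"
  have "vertex_ordering G ?r"
    unfolding vertex_ordering_def strict_linear_order_on_def
  proof (intro conjI)
    show "trans ?r" by (rule transI) auto
    show "irrefl ?r" by (simp add: irrefl_def)
    show "total_on (verts G) ?r"
      using f by (simp add: total_on_def inj_on_def) (meson linorder_neqE_nat)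
  qed auto
  then show ?thesis ..
qed

lemma ex_book_embedding:
  assumes "finite_simple_graph G"
  shows "\<exists>r P. book_embedding G r P"
proof -
  obtain r where r: "vertex_ordering G r"
    using ex_vertex_ordering[OF assms] ..
  have "partition_on (edges G) ((\<lambda>e. {e}) ` edges G)"
    by (auto simp: partition_on_def disjoint_def)
  then have "book_embedding G r ((\<lambda>e. {e}) ` edges G)"
    using r by (auto simp: book_embedding_def linear_layout_def page_def not_crossing_self)
  then show ?thesis by blast
qed

lemma finite_partition_edges:
  assumes "finite_simple_graph G" "partition_on (edges G) P"
  shows "finite P"
proof -
  have "finite (edges G)"
    using assms(1) finite_subset[OF _ finite_imp_finite_nsets]
    unfolding finite_simple_graph_def by auto
  then show ?thesis using assms(2) by (rule finite_elements)
qed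

lemma union_page_page:
  assumes "page r F"
  shows "union_page r F"
  unfolding union_page_def using assms by (intro exI[of _ "{F}"]) auto

lemma local_page_number_attained:
  assumes "finite_simple_graph G"
  shows "\<exists>r P. book_embedding G r P \<and> k_local (local_page_number G) G P"
proof -
  obtain r P where P: "book_embedding G r P"
    using ex_book_embedding[OF assms] by blast
  then have "finite P"
    using finite_partition_edges[OF assms] by (auto simp: book_embedding_def linear_layout_def)
  then have "k_local (card P) G P"
    by (simp add: k_local_def card_mono)
  with P have "\<exists>k r P. book_embedding G r P \<and> k_local k G P" by blast
  then show ?thesis unfolding local_page_number_def by (rule LeastI_ex)
qed

lemma union_page_number_attained:
  assumes "finite_simple_graph G"
  shows "\<exists>r P. linear_layout G r P \<and> (\<forall>U\<in>P. union_page r U) \<and> card P \<le> union_page_number G"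
proof -
  obtain r P where "book_embedding G r P"
    using ex_book_embedding[OF assms] by blast
  then have "\<exists>k r P. linear_layout G r P \<and> (\<forall>U\<in>P. union_page r U) \<and> card P \<le> k"
    unfolding book_embedding_def using union_page_page by blast
  then show ?thesis unfolding union_page_number_def by (rule LeastI_ex)
qed

end

theory Submission
  imports Defs "HOL-Number_Theory.Cong" "HOL-Library.Nat_Bijection"
begin

text \<open>
  Three facts are combined.

  Lower bound for the local page number. Give an edge whose endpoints have cyclic distance \<open>d\<close> in the
  vertex ordering the weight \<open>min q d\<close>, where \<open>q\<close> is \<open>n / 3\<close> rounded up. A page on \<open>m\<close> vertices
  is a polygon with at most \<open>m - 3\<close> diagonals. The sides of the polygon wind once around the circle, so
  they weigh at most \<open>n \<le> 3 * q\<close> together, and the diagonals weigh at most \<open>q\<close> each. Hence a page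
  weighs at most \<open>q\<close> times its number of vertices (\<open>noncrossing_pairs_cyclic_weight\<close>). Comparing
  with the weight of all edges bounds the number of pages at an average vertex from below by about
  \<open>n / 3\<close> (\<open>local_page_number_complete_graph_ge\<close>).

  Upper bound for the local page number. Equality requires polygons whose sides are shorter and whose
  diagonals are longer than a third of the circle. On \<open>18 * N\<close> vertices there are \<open>N + 1\<close> triangulated
  hexagons of this kind in which every length up to \<open>9 * N\<close> occurs; their rotations cover
  all edges, and each vertex lies in at most \<open>6 * (N + 1)\<close> of them
  (\<open>hexagon_chords\<close>, \<open>local_page_number_complete_graph_le\<close>).

  Upper bound for the union page number. The complete graph on eight vertices splits into three
  union pages made of 4-cycles, four of them with a diagonal. Blowing up each vertex to a block of odd size \<open>M\<close> turns
  every union page into \<open>M\<close> union pages of disjoint copies, which leaves only the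
  edges inside the blocks to recursion (\<open>union_coverable_blowup\<close>). The recursion solves to about
  \<open>3 * n / 7\<close>, which is below the required \<open>4 * n / 9\<close>.
\<close>

section \<open>Layouts from coverings\<close>

definition natural_order :: "nat \<Rightarrow> nat rel" where
  "natural_order n = {(x, y). x < y \<and> y < n}"

lemma vertex_ordering_natural_order:
  "vertex_ordering (complete_graph n) (natural_order n)"
  unfolding vertex_ordering_def strict_linear_order_on_def
  by (auto simp: complete_graph_def natural_order_def trans_def irrefl_def total_on_def)

lemma complete_graph_edgeE:
  assumes "e \<in> edges (complete_graph n)"
  obtains x y where "e = {x, y}" "x < y" "y < n"
proof -
  obtain x y where "e = {x, y}" "x \<noteq> y" "x < n" "y < n"
    using assms by (auto simp: complete_graph_def nsets_2_eq)
  then show thesis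
    by (metis doubleton_eq_iff linorder_neqE_nat that)
qed

lemma crossing_natural_orderE:
  assumes "crossing (natural_order n) e f"
  obtains a b c d where "e = {a, b} \<and> f = {c, d} \<or> e = {c, d} \<and> f = {a, b}"
    "a < c" "c < b" "b < d" "d < n"
proof -
  obtain v w x y where ef: "e = {v, w}" "f = {x, y}"
    and lt: "v < w" "w < n" "x < y" "y < n" "v < x \<and> x < w \<and> w < y \<or> x < v \<and> v < y \<and> y < w"
    using assms by (auto simp: crossing_def natural_order_def)
  from lt(5) show thesis
  proof
    assume "v < x \<and> x < w \<and> w < y"
    with ef lt show thesis by (intro that[of v w x y]) simp_all
  next
    assume "x < v \<and> v < y \<and> y < w"
    with ef lt show thesis by (intro that[of x y v w]) simp_all
  qed
qed

lemma page_subset: "page r F \<Longrightarrow> F' \<subseteq> F \<Longrightarrow> page r F'"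
  unfolding page_def by blast

lemma incident_edges_nonempty_iff: "incident_edges v F \<noteq> {} \<longleftrightarrow> v \<in> \<Union>F"
  unfolding incident_edges_def by blast

text \<open>
  The parts of a layout may be given as an overlapping family: pages and union pages are closed
  under subsets, so each edge can be kept in one chosen member of the family only. The function
  \<open>g\<close> remembers which member a part was cut out of, so that counting parts
  reduces to counting indices.
\<close>

lemma partition_from_cover:
  assumes cover: "\<And>e. e \<in> S \<Longrightarrow> \<exists>j\<in>J. e \<in> F j" and J: "finite J"
  obtains P g where "partition_on S P" "inj_on g P" "\<And>A. A \<in> P \<Longrightarrow> g A \<in> J \<and> A \<subseteq> F (g A)"
proof -
  obtain h where h: "\<And>e. e \<in> S \<Longrightarrow> h e \<in> J \<and> e \<in> F (h e)"
    using cover by metis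
  define P where "P = (\<lambda>j. {e \<in> S. h e = j}) ` h ` S"
  have P_iff: "A \<in> P \<longleftrightarrow> (\<exists>e\<in>S. A = {e' \<in> S. h e' = h e})" for A
    by (auto simp: P_def)
  have "partition_on S P"
    unfolding partition_on_def disjoint_def
  proof (intro conjI ballI impI)
    show "\<Union>P = S" using P_iff by blast
    show "A \<inter> B = {}" if "A \<in> P" "B \<in> P" "A \<noteq> B" for A B
      using that P_iff by auto
    show "{} \<notin> P" using P_iff by blast
  qed
  moreover define g where "g A = h (SOME e. e \<in> A)" for A
  have g: "g {e \<in> S. h e = j} = j" if "j \<in> h ` S" for j
  proof -
    have "(SOME e. e \<in> {e \<in> S. h e = j}) \<in> {e \<in> S. h e = j}"
      using that by (subst some_in_eq) auto
    then show ?thesis by (simp add: g_def)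
  qed
  have P_g: "A = {e \<in> S. h e = g A} \<and> g A \<in> h ` S" if "A \<in> P" for A
  proof -
    obtain e where e: "e \<in> S" "A = {e' \<in> S. h e' = h e}" using \<open>A \<in> P\<close> P_iff by blast
    then have "g A = h e" using g[of "h e"] by simp
    with e show ?thesis by simp
  qed
  have "inj_on g P"
    by (rule inj_onI) (metis P_g)
  moreover have "g A \<in> J \<and> A \<subseteq> F (g A)" if "A \<in> P" for A
    using P_g[OF that] h by (smt (verit) imageE mem_Collect_eq subsetI)
  ultimately show thesis using that by blast
qed

lemma local_page_number_le_cover:
  assumes r: "vertex_ordering G r" and J: "finite J"
    and pages: "\<And>j. j \<in> J \<Longrightarrow> page r (F j)"
    and cover: "\<And>e. e \<in> edges G \<Longrightarrow> \<exists>j\<in>J. e \<in> F j"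
    and load: "\<And>v. v \<in> verts G \<Longrightarrow> card {j \<in> J. v \<in> \<Union>(F j)} \<le> k"
  shows "local_page_number G \<le> k"
proof -
  obtain P g where P: "partition_on (edges G) P" and inj: "inj_on g P"
    and g: "\<And>A. A \<in> P \<Longrightarrow> g A \<in> J \<and> A \<subseteq> F (g A)"
    using partition_from_cover[OF cover J] by metis
  have "book_embedding G r P"
    using r P g pages page_subset by (fastforce simp: book_embedding_def linear_layout_def)
  moreover have "k_local k G P"
    unfolding k_local_def
  proof
    fix v assume v: "v \<in> verts G"
    have "card {A \<in> P. incident_edges v A \<noteq> {}} = card (g ` {A \<in> P. v \<in> \<Union>A})"
      using inj by (simp add: incident_edges_nonempty_iff card_image inj_on_subset)
    also have "\<dots> \<le> card {j \<in> J. v \<in> \<Union>(F j)}"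
    proof (rule card_mono)
      show "finite {j \<in> J. v \<in> \<Union>(F j)}" using J by simp
      show "g ` {A \<in> P. v \<in> \<Union>A} \<subseteq> {j \<in> J. v \<in> \<Union>(F j)}" using g by fast
    qed
    finally show "card {A \<in> P. incident_edges v A \<noteq> {}} \<le> k"
      using load[OF v] by linarith
  qed
  ultimately show ?thesis
    unfolding local_page_number_def by (intro Least_le) blast
qed

text \<open>
  The connected pieces of a union page can be named by a label on the vertices. Then edges join
  vertices of equal label, and only edges of different labels may cross.
\<close>

lemma union_page_if_labelled:
  assumes const: "\<And>e x y. e \<in> F \<Longrightarrow> x \<in> e \<Longrightarrow> y \<in> e \<Longrightarrow> \<kappa> x = \<kappa> y"
    and sep: "\<And>e f x y. e \<in> F \<Longrightarrow> f \<in> F \<Longrightarrow> crossing r e f \<Longrightarrow> x \<in> e \<Longrightarrow> y \<in> f \<Longrightarrow> \<kappa> x \<noteq> \<kappa> y"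
  shows "union_page r F"
  unfolding union_page_def
proof (intro exI[of _ "range (\<lambda>c. {e \<in> F. \<forall>x\<in>e. \<kappa> x = c})"] conjI ballI impI notI)
  show "F = \<Union>(range (\<lambda>c. {e \<in> F. \<forall>x\<in>e. \<kappa> x = c}))"
  proof (intro equalityI subsetI)
    fix e assume "e \<in> F"
    then have "\<forall>x\<in>e. \<kappa> x = \<kappa> (SOME x. x \<in> e)"
      using const by (metis someI)
    then show "e \<in> \<Union>(range (\<lambda>c. {e \<in> F. \<forall>x\<in>e. \<kappa> x = c}))"
      using \<open>e \<in> F\<close> by blast
  qed blast
next
  fix A assume "A \<in> range (\<lambda>c. {e \<in> F. \<forall>x\<in>e. \<kappa> x = c})"
  then obtain c where A: "A = {e \<in> F. \<forall>x\<in>e. \<kappa> x = c}" by blast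
  show "page r A"
    unfolding page_def
  proof (intro ballI notI)
    fix e f assume ef: "e \<in> A" "f \<in> A" "crossing r e f"
    then obtain x y where "x \<in> e" "y \<in> f" unfolding crossing_def by blast
    with sep[of e f x y] ef A show False by simp
  qed
next
  fix A B
  assume "A \<in> range (\<lambda>c. {e \<in> F. \<forall>x\<in>e. \<kappa> x = c})" "B \<in> range (\<lambda>c. {e \<in> F. \<forall>x\<in>e. \<kappa> x = c})"
    and "A \<noteq> B" "\<exists>v. incident_edges v A \<noteq> {} \<and> incident_edges v B \<noteq> {}"
  then show False by (force simp: incident_edges_def)
qed

lemma union_page_subset:
  assumes "union_page r F" "F' \<subseteq> F"
  shows "union_page r F'"
proof -
  obtain Q where Q: "F = \<Union>Q" "\<And>A. A \<in> Q \<Longrightarrow> page r A"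
    "\<And>A B v. A \<in> Q \<Longrightarrow> B \<in> Q \<Longrightarrow> v \<in> \<Union>A \<Longrightarrow> v \<in> \<Union>B \<Longrightarrow> A = B"
    using assms(1) unfolding union_page_def incident_edges_nonempty_iff by metis
  show ?thesis
    unfolding union_page_def incident_edges_nonempty_iff
  proof (intro exI[of _ "(\<lambda>A. A \<inter> F') ` Q"] conjI ballI impI notI)
    show "F' = \<Union>((\<lambda>A. A \<inter> F') ` Q)" using Q(1) assms(2) by auto
    show "page r A" if "A \<in> (\<lambda>A. A \<inter> F') ` Q" for A
      using that Q(2) page_subset by blast
    show False if A: "A \<in> (\<lambda>A. A \<inter> F') ` Q" and B: "B \<in> (\<lambda>A. A \<inter> F') ` Q" and "A \<noteq> B"
      and v: "\<exists>v. v \<in> \<Union>A \<and> v \<in> \<Union>B" for A B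
    proof -
      obtain A' B' where AB: "A = A' \<inter> F'" "A' \<in> Q" "B = B' \<inter> F'" "B' \<in> Q" using A B by blast
      with v have "\<exists>v. v \<in> \<Union>A' \<and> v \<in> \<Union>B'" by blast
      then have "A' = B'" using Q(3)[OF AB(2,4)] by blast
      with AB \<open>A \<noteq> B\<close> show False by simp
    qed
  qed
qed

lemma union_page_number_le_cover:
  assumes r: "vertex_ordering G r" and J: "finite J"
    and pages: "\<And>j. j \<in> J \<Longrightarrow> union_page r (F j)"
    and cover: "\<And>e. e \<in> edges G \<Longrightarrow> \<exists>j\<in>J. e \<in> F j"
  shows "union_page_number G \<le> card J"
proof -
  obtain P g where P: "partition_on (edges G) P" and inj: "inj_on g P"
    and g: "\<And>A. A \<in> P \<Longrightarrow> g A \<in> J \<and> A \<subseteq> F (g A)"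
    using partition_from_cover[OF cover J] by metis
  have "linear_layout G r P" using r P by (simp add: linear_layout_def)
  moreover have "\<forall>U\<in>P. union_page r U" using g pages union_page_subset by blast
  moreover have "card P \<le> card J"
    using inj g J by (intro card_inj_on_le[of g]) auto
  ultimately show ?thesis
    unfolding union_page_number_def by (intro Least_le) blast
qed

section \<open>Local versus union page number\<close>

text \<open>
  Split every union page into its vertex-disjoint pages. A vertex meets at most one page of each
  union page, so the resulting book embedding is \<open>k\<close>-local when there are
  \<open>k\<close> union pages.
\<close>

lemma local_page_number_le_union_page_number:
  assumes "finite_simple_graph G"
  shows "local_page_number G \<le> union_page_number G"
proof -
  obtain r P where layout: "linear_layout G r P" and up: "\<And>U. U \<in> P \<Longrightarrow> union_page r U"
    and card: "card P \<le> union_page_number G"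
    using union_page_number_attained[OF assms] by blast
  have P: "partition_on (edges G) P" and r: "vertex_ordering G r"
    using layout by (auto simp: linear_layout_def)
  have finP: "finite P"
    using finite_partition_edges[OF assms P] .
  obtain Q where Q: "\<And>U. U \<in> P \<Longrightarrow> U = \<Union>(Q U) \<and> (\<forall>A\<in>Q U. page r A) \<and>
      (\<forall>A\<in>Q U. \<forall>B\<in>Q U. A \<noteq> B \<longrightarrow> \<not> (\<exists>v. v \<in> \<Union>A \<and> v \<in> \<Union>B))"
    using up unfolding union_page_def incident_edges_nonempty_iff by metis
  have finE: "finite (edges G)"
    using assms finite_subset[OF _ finite_imp_finite_nsets]
    unfolding finite_simple_graph_def by auto
  have finQ: "finite (Q U)" if "U \<in> P" for U
  proof -
    have "U \<subseteq> edges G" using P that by (auto simp: partition_on_def)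
    then have "finite (\<Union>(Q U))" using Q[OF that] finE by (metis finite_subset)
    then show ?thesis by (rule finite_UnionD)
  qed
  show ?thesis
  proof (rule order_trans[OF _ card], rule local_page_number_le_cover[OF r, where F = snd])
    show "finite (Sigma P Q)" using finP finQ by blast
    show "page r (snd j)" if "j \<in> Sigma P Q" for j using that Q by auto
    show "\<exists>j\<in>Sigma P Q. e \<in> snd j" if e: "e \<in> edges G" for e
    proof -
      obtain U where U: "U \<in> P" "e \<in> U"
        using e P by (auto simp: partition_on_def)
      with Q[OF U(1)] obtain A where "A \<in> Q U" "e \<in> A" by blast
      with U show ?thesis by force
    qed
    fix v
    have "inj_on fst {j \<in> Sigma P Q. v \<in> \<Union>(snd j)}"
    proof (rule inj_onI)
      fix i j assume i: "i \<in> {j \<in> Sigma P Q. v \<in> \<Union>(snd j)}"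
        and j: "j \<in> {j \<in> Sigma P Q. v \<in> \<Union>(snd j)}" and eq: "fst i = fst j"
      have "fst i \<in> P" "snd i \<in> Q (fst i)" "snd j \<in> Q (fst i)" using i j eq by auto
      then have "snd i = snd j" using Q[of "fst i"] i j by blast
      with eq show "i = j" by (simp add: prod_eq_iff)
    qed
    moreover have "fst ` {j \<in> Sigma P Q. v \<in> \<Union>(snd j)} \<subseteq> P" by auto
    ultimately show "card {j \<in> Sigma P Q. v \<in> \<Union>(snd j)} \<le> card P"
      using finP card_inj_on_le by blast
  qed
qed

section \<open>Lower bound for the local page number\<close>

text \<open>
  An outerplanar graph on \<open>m\<close> vertices has at most \<open>m - 2\<close> edges besides those of the
  path along its vertices in their order, and the edges of that path together have length
  \<open>h - l\<close>. Weighting an edge with its length truncated at \<open>q\<close>, path edges are charged by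
  length and all other edges by \<open>q\<close>, which is the bound below. The induction cuts the vertex set
  at the farthest neighbour \<open>c\<close> of the leftmost vertex \<open>l\<close> other than \<open>h\<close>: no edge
  except \<open>(l, h)\<close> can pass over \<open>c\<close>. If there is no such neighbour, \<open>l\<close> is removed.
\<close>

lemma noncrossing_pairs_weight:
  fixes V :: "nat set" and E :: "(nat \<times> nat) set" and q l h :: nat
  assumes "finite V" "l \<in> V" "h \<in> V" "l < h" "V \<subseteq> {l..h}"
    and "E \<subseteq> {(a, b) \<in> V \<times> V. a < b}"
    and "\<And>a b c d. (a, b) \<in> E \<Longrightarrow> (c, d) \<in> E \<Longrightarrow> \<not> (a < c \<and> c < b \<and> b < d)"
  shows "(\<Sum>(a, b)\<in>E. min q (b - a)) + 2 * q \<le> q * card V + (h - l)"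
  using assms
proof (induction "card V" arbitrary: V E l h rule: less_induct)
  case less
  note V = less.prems(1-5) and E = less.prems(6) and nc = less.prems(7)
  have finE: "finite E"
    by (rule finite_subset[of _ "V \<times> V"]) (use E V(1) in auto)
  define E' where "E' = E - {(l, h)}"
  have E': "finite E'" "E' \<subseteq> {(a, b) \<in> V \<times> V. a < b}" "(l, h) \<notin> E'"
    using finE E by (auto simp: E'_def)
  have nc': "\<And>a b c d. (a, b) \<in> E' \<Longrightarrow> (c, d) \<in> E' \<Longrightarrow> \<not> (a < c \<and> c < b \<and> b < d)"
    using nc by (auto simp: E'_def)
  have "(\<Sum>(a, b)\<in>E. min q (b - a)) \<le> (\<Sum>(a, b)\<in>insert (l, h) E'. min q (b - a))"
    using finE by (intro sum_mono2) (auto simp: E'_def)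
  also have "\<dots> = min q (h - l) + (\<Sum>(a, b)\<in>E'. min q (b - a))"
    using E' by simp
  finally have split: "(\<Sum>(a, b)\<in>E. min q (b - a)) \<le> min q (h - l) + (\<Sum>(a, b)\<in>E'. min q (b - a))" .
  show ?case
  proof (cases "V = {l, h}")
    case True
    then have "E' = {}" using E' \<open>l < h\<close> by auto
    moreover have "card V = 2" using True \<open>l < h\<close> by simp
    ultimately show ?thesis using split \<open>l < h\<close> by auto
  next
    case False
    have card3: "q * card V + (h - l) \<ge> (\<Sum>(a, b)\<in>E'. min q (b - a)) + 3 * q"
    proof (cases "\<exists>c. (l, c) \<in> E'")
      case True
      define C where "C = {c. (l, c) \<in> E'}"
      have "C \<subseteq> V" using E' by (auto simp: C_def)
      then have C: "finite C" "C \<noteq> {}" using V(1) True finite_subset by (auto simp: C_def)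
      define c where "c = Max C"
      have "c \<in> C" and cmax: "\<And>b. (l, b) \<in> E' \<Longrightarrow> b \<le> c"
        using Max_in[OF C] Max_ge[OF C(1)] by (auto simp: c_def C_def)
      then have lc: "(l, c) \<in> E'" by (simp add: C_def)
      with E' have "c \<in> V" "l < c" "c \<noteq> h" by auto
      moreover from this V(5) have "c < h" by force
      ultimately have c: "(l, c) \<in> E'" "c \<in> V" "l < c" "c < h" using lc by simp_all
      define V1 where "V1 = V \<inter> {l..c}"
      define V2 where "V2 = V \<inter> {c..h}"
      define E1 where "E1 = {(a, b) \<in> E'. b \<le> c}"
      define E2 where "E2 = {(a, b) \<in> E'. c \<le> a}"
      have "h \<notin> V1" "l \<notin> V2"
        using c by (simp_all add: V1_def V2_def)
      then have "V1 \<subset> V" "V2 \<subset> V"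
        using V(2,3) unfolding V1_def V2_def by blast+
      then have lt: "card V1 < card V" "card V2 < card V"
        using V(1) by (simp_all add: psubset_card_mono)
      have "V1 \<union> V2 = V" "V1 \<inter> V2 = {c}"
        using V(5) c(2) unfolding V1_def V2_def by force+
      then have card: "card V1 + card V2 = card V + 1"
        using card_Un_Int[of V1 V2] V(1) by (simp add: V1_def V2_def)
      have "E' = E1 \<union> E2"
      proof (intro equalityI subsetI)
        fix e assume e: "e \<in> E'"
        obtain a b where ab: "e = (a, b)" by fastforce
        have "l \<le> a" using e E' V(5) ab by auto
        have "b \<le> c \<or> c \<le> a"
        proof (rule ccontr)
          assume "\<not> (b \<le> c \<or> c \<le> a)"
          moreover from this have "a \<noteq> l" using cmax e ab by auto
          ultimately show False using nc'[OF c(1), of a b] e ab \<open>l \<le> a\<close> by simp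
        qed
        then show "e \<in> E1 \<union> E2" using e ab by (auto simp: E1_def E2_def)
      qed (auto simp: E1_def E2_def)
      moreover have "E1 \<inter> E2 = {}" using E' by (auto simp: E1_def E2_def)
      ultimately have sum: "(\<Sum>(a, b)\<in>E'. min q (b - a))
          = (\<Sum>(a, b)\<in>E1. min q (b - a)) + (\<Sum>(a, b)\<in>E2. min q (b - a))"
        using E'(1) by (simp add: sum.union_disjoint)
      have 1: "(\<Sum>(a, b)\<in>E1. min q (b - a)) + 2 * q \<le> q * card V1 + (c - l)"
      proof (rule less.hyps[OF lt(1)])
        show "finite V1" "l \<in> V1" "c \<in> V1" "V1 \<subseteq> {l..c}" using V(1,2) c by (simp_all add: V1_def)
        show "E1 \<subseteq> {(a, b) \<in> V1 \<times> V1. a < b}"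
          using E'(2) V(5) unfolding E1_def V1_def by fastforce
        show "\<not> (a < c' \<and> c' < b \<and> b < d)" if "(a, b) \<in> E1" "(c', d) \<in> E1" for a b c' d
          using nc'[of a b c' d] that by (simp add: E1_def)
      qed (rule c)
      have 2: "(\<Sum>(a, b)\<in>E2. min q (b - a)) + 2 * q \<le> q * card V2 + (h - c)"
      proof (rule less.hyps[OF lt(2)])
        show "finite V2" "c \<in> V2" "h \<in> V2" "V2 \<subseteq> {c..h}" using V(1,3) c by (simp_all add: V2_def)
        show "E2 \<subseteq> {(a, b) \<in> V2 \<times> V2. a < b}"
          using E'(2) V(5) unfolding E2_def V2_def by fastforce
        show "\<not> (a < c' \<and> c' < b \<and> b < d)" if "(a, b) \<in> E2" "(c', d) \<in> E2" for a b c' d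
          using nc'[of a b c' d] that by (simp add: E2_def)
      qed (rule c)
      have "q * card V1 + q * card V2 = q * card V + q"
        using card by (metis add_mult_distrib2 mult.right_neutral)
      then show ?thesis using 1 2 sum c by linarith
    next
      case none: False
      define V' where "V' = V - {l}"
      define l' where "l' = Min V'"
      have V': "finite V'" "h \<in> V'" using V by (auto simp: V'_def)
      have card': "card V = card V' + 1" using card_Suc_Diff1[OF V(1,2)] by (simp add: V'_def)
      obtain x where "x \<in> V'" "x \<noteq> h" using False V by (auto simp: V'_def)
      then have "x < h" using V(5) by (auto simp: V'_def)
      have "l' \<in> V'" using Min_in[OF V'(1)] V'(2) by (auto simp: l'_def)
      moreover have "l' \<le> x" using V'(1) \<open>x \<in> V'\<close> by (simp add: l'_def)
      moreover have "l < l'" using \<open>l' \<in> V'\<close> V(5) by (force simp: V'_def)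
      ultimately have l': "l' \<in> V'" "l' < h" "l < l'" using \<open>x < h\<close> by auto
      have "(\<Sum>(a, b)\<in>E'. min q (b - a)) + 2 * q \<le> q * card V' + (h - l')"
      proof (rule less.hyps)
        show "card V' < card V" using card' by simp
        show "V' \<subseteq> {l'..h}"
          using Min_le[OF V'(1)] V(5) unfolding l'_def[symmetric] by (force simp: V'_def)
        show "E' \<subseteq> {(a, b) \<in> V' \<times> V'. a < b}"
        proof (rule subsetI)
          fix e assume e: "e \<in> E'"
          obtain a b where ab: "e = (a, b)" by fastforce
          have "a \<in> V" "b \<in> V" "a < b" "a \<noteq> l" using e ab E'(2) none by auto
          moreover from this have "b \<noteq> l" using V(5) by force
          ultimately show "e \<in> {(a, b) \<in> V' \<times> V'. a < b}" using ab by (simp add: V'_def)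
        qed
      qed (use V' l' nc' in simp_all)
      moreover have "q * card V = q * card V' + q" using card' by simp
      ultimately show ?thesis using l' by linarith
    qed
    then show ?thesis using split by linarith
  qed
qed

text \<open>
  On a circle the extreme vertices \<open>l\<close> and \<open>h\<close> are consecutive as well, and the edge
  \<open>(l, h)\<close> is charged with the length \<open>n - (h - l)\<close> of the arc outside. The polygon through all
  vertices then has total length \<open>n \<le> 3 * q\<close>, while the at most \<open>m - 3\<close> diagonals
  contribute \<open>q\<close> each, and this adds up to \<open>q * m\<close>.
\<close>

lemma noncrossing_pairs_cyclic_weight:
  fixes V :: "nat set" and E :: "(nat \<times> nat) set" and q n :: nat
  assumes V: "V \<subseteq> {..<n}" and q: "n \<le> 3 * q"
    and E: "E \<subseteq> {(a, b) \<in> V \<times> V. a < b}"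
    and nc: "\<And>a b c d. (a, b) \<in> E \<Longrightarrow> (c, d) \<in> E \<Longrightarrow> \<not> (a < c \<and> c < b \<and> b < d)"
  shows "(\<Sum>(a, b)\<in>E. min q (min (b - a) (n - (b - a)))) \<le> q * card V"
proof (cases "E = {}")
  case False
  then obtain a0 b0 where ab0: "a0 \<in> V" "b0 \<in> V" "a0 < b0" using E by fastforce
  have finV: "finite V" using V finite_subset by blast
  have finE: "finite E"
    by (rule finite_subset[of _ "V \<times> V"]) (use E finV in auto)
  define l where "l = Min V"
  define h where "h = Max V"
  have "V \<noteq> {}" using ab0 by auto
  then have lh: "l \<in> V" "h \<in> V" "V \<subseteq> {l..h}"
    using finV by (auto simp: l_def h_def)
  then have "l < h" using ab0
    by (meson atLeastAtMost_iff order_less_le_trans order_le_less_trans subsetD)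
  have "h < n" using lh V by auto
  define s where "s = (\<Sum>(a, b)\<in>E - {(l, h)}. min q (b - a))"
  have "(\<Sum>(a, b)\<in>insert (l, h) E. min q (b - a)) + 2 * q \<le> q * card V + (h - l)"
  proof (rule noncrossing_pairs_weight[OF finV lh(1,2) \<open>l < h\<close> lh(3)])
    show "insert (l, h) E \<subseteq> {(a, b) \<in> V \<times> V. a < b}" using E lh \<open>l < h\<close> by auto
    fix a b c d assume e: "(a, b) \<in> insert (l, h) E" "(c, d) \<in> insert (l, h) E"
    have "l \<le> a" "d \<le> h" using e E lh \<open>l < h\<close> by auto
    with e nc show "\<not> (a < c \<and> c < b \<and> b < d)" by auto
  qed
  moreover have "(\<Sum>(a, b)\<in>insert (l, h) E. min q (b - a)) = min q (h - l) + s"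
    using finE by (simp add: sum.insert_remove s_def)
  ultimately have A: "min q (h - l) + s + 2 * q \<le> q * card V + (h - l)" by simp
  have "(\<Sum>(a, b)\<in>E. min q (min (b - a) (n - (b - a))))
      \<le> (\<Sum>(a, b)\<in>insert (l, h) E. min q (min (b - a) (n - (b - a))))"
    using finE by (intro sum_mono2) auto
  also have "\<dots> = min q (min (h - l) (n - (h - l)))
      + (\<Sum>(a, b)\<in>E - {(l, h)}. min q (min (b - a) (n - (b - a))))"
    using finE by (simp add: sum.insert_remove)
  also have "(\<Sum>(a, b)\<in>E - {(l, h)}. min q (min (b - a) (n - (b - a)))) \<le> s"
    unfolding s_def by (intro sum_mono) auto
  finally have "(\<Sum>(a, b)\<in>E. min q (min (b - a) (n - (b - a))))
      \<le> min q (min (h - l) (n - (h - l))) + s" by simp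
  then show ?thesis using A q \<open>h < n\<close> by linarith
qed simp

text \<open>
  Raising the truncation level from \<open>q\<close> to \<open>q + 1\<close> adds 1 for each \<open>d\<close> strictly between
  \<open>q\<close> and \<open>n - q\<close>. There are at least \<open>n - 2 * q - 1\<close> of these, also when this
  number is negative.
\<close>

lemma sum_truncated_cyclic_distance:
  fixes n q :: nat
  shows "int q * (int n - int q) \<le> (\<Sum>d\<in>{1..<n}. int (min q (min d (n - d))))"
proof (induction q)
  case (Suc q)
  have "(\<Sum>d\<in>{1..<n}. int (min (Suc q) (min d (n - d))))
      = (\<Sum>d\<in>{1..<n}. int (min q (min d (n - d))) + (if q < d \<and> q < n - d then 1 else 0))"
    by (intro sum.cong) auto
  also have "\<dots> = (\<Sum>d\<in>{1..<n}. int (min q (min d (n - d)))) + int (card {d \<in> {1..<n}. q < d \<and> q < n - d})"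
    by (simp add: sum.distrib sum.If_cases Int_def)
  also have "{d \<in> {1..<n}. q < d \<and> q < n - d} = {q<..<n - q}"
    by auto
  finally show ?case using Suc by (simp add: algebra_simps of_nat_diff)
qed simp

lemma sum_over_circle:
  fixes W :: "nat \<Rightarrow> nat"
  assumes x: "x < n" and sym: "\<And>d. d < n \<Longrightarrow> 0 < d \<Longrightarrow> W (n - d) = W d"
  shows "(\<Sum>y\<in>{..<n} - {x}. W (if x < y then y - x else x - y)) = (\<Sum>d\<in>{1..<n}. W d)"
proof (rule sum.reindex_bij_witness[where
    j = "\<lambda>y. if x < y then y - x else y + n - x" and i = "\<lambda>d. if x + d < n then x + d else x + d - n"])
  fix y assume "y \<in> {..<n} - {x}"
  then show "W (if x < y then y - x else y + n - x) = W (if x < y then y - x else x - y)"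
    using sym[of "x - y"] x by (auto simp: Nat.diff_diff_right add.commute)
qed (use x in auto)

text \<open>
  By double counting. Summed over all pages, the number of vertices of a page is the
  number of incidences between vertices and pages, at most \<open>n * k\<close>. The weight of a page is at
  most \<open>q\<close> times its number of vertices, and the weight of all edges of the complete graph is
  \<open>n / 2\<close> times the sum of the truncated cyclic distances, at least \<open>n * q * (n - q) / 2\<close>.
\<close>

lemma local_page_number_complete_graph_ge:
  fixes n q :: nat
  assumes q: "n \<le> 3 * q" and n: "0 < n" "0 < q"
  shows "int n - int q \<le> 2 * int (local_page_number (complete_graph n))"
proof -
  define k where "k = local_page_number (complete_graph n)"
  obtain r P where book: "book_embedding (complete_graph n) r P" and k: "k_local k (complete_graph n) P"
    using local_page_number_attained[OF finite_simple_graph_complete_graph] unfolding k_def by blast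
  have P: "partition_on (nsets {..<n} 2) P" and pages: "\<And>A. A \<in> P \<Longrightarrow> page r A"
    and r: "r \<subseteq> {..<n} \<times> {..<n}" "trans r" "irrefl r" "total_on {..<n} r"
    using book by (auto simp: book_embedding_def linear_layout_def vertex_ordering_def
        strict_linear_order_on_def complete_graph_def)
  \<comment> \<open>Positions in the vertex ordering replace the vertices, so that lengths make sense for every ordering.\<close>
  define pos where "pos x = card {z. (z, x) \<in> r}" for x
  have fin: "finite {z. (z, x) \<in> r}" for x
    by (rule finite_subset[of _ "{..<n}"]) (use r in auto)
  have pos_less: "pos x < pos y" if "(x, y) \<in> r" for x y
    unfolding pos_def
  proof (rule psubset_card_mono[OF fin])
    have "(x, x) \<notin> r" using r(3) by (simp add: irrefl_def)
    then show "{z. (z, x) \<in> r} \<subset> {z. (z, y) \<in> r}"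
      using that r(2) by (blast dest: transD)
  qed
  have pos_iff: "(x, y) \<in> r \<longleftrightarrow> pos x < pos y" if "x < n" "y < n" for x y
  proof
    assume lt: "pos x < pos y"
    then have "x \<noteq> y" by auto
    then have "(x, y) \<in> r \<or> (y, x) \<in> r" using r(4) that by (simp add: total_on_def)
    then show "(x, y) \<in> r" using pos_less[of y x] lt by auto
  qed (rule pos_less)
  have inj: "inj_on pos {..<n}"
    using r(4) pos_less by (force simp: inj_on_def total_on_def)
  have range: "pos ` {..<n} \<subseteq> {..<n}"
  proof -
    have "pos x < n" if "x < n" for x
    proof -
      have "(x, x) \<notin> r" using r(3) by (simp add: irrefl_def)
      then have "{z. (z, x) \<in> r} \<subset> {..<n}" using r(1) that by auto
      then show ?thesis unfolding pos_def using psubset_card_mono[of "{..<n}"] by auto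
    qed
    then show ?thesis by auto
  qed
  then have bij: "bij_betw pos {..<n} {..<n}"
    using inj by (simp add: bij_betw_def card_image card_subset_eq endo_inj_surj)
  define W where "W d = min q (min d (n - d))" for d
  define dist where "dist x y = (if pos x < pos y then pos y - pos x else pos x - pos y)" for x y
  define Arc where "Arc A = {(x, y). {x, y} \<in> A \<and> pos x < pos y}" for A
  have page_bound: "(\<Sum>(x, y)\<in>Arc A. W (dist x y)) \<le> q * card (\<Union>A)" if A: "A \<in> P" for A
  proof -
    have An: "A \<subseteq> nsets {..<n} 2" using A P by (auto simp: partition_on_def)
    then have sub: "\<Union>A \<subseteq> {..<n}" by (auto simp: nsets_def)
    have ArcA: "x < n" "y < n" if "(x, y) \<in> Arc A" for x y
      using that sub by (auto simp: Arc_def)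
    define E where "E = map_prod pos pos ` Arc A"
    have "inj_on (map_prod pos pos) (Arc A)"
      by (rule inj_on_subset[OF map_prod_inj_on[OF inj inj]]) (use ArcA in auto)
    then have "(\<Sum>(x, y)\<in>Arc A. W (dist x y)) = (\<Sum>(a, b)\<in>E. W (b - a))"
      unfolding E_def by (subst sum.reindex) (auto simp: Arc_def dist_def intro!: sum.cong)
    also have "\<dots> \<le> q * card (pos ` \<Union>A)"
      unfolding W_def
    proof (rule noncrossing_pairs_cyclic_weight[OF _ q])
      show "pos ` \<Union>A \<subseteq> {..<n}" using sub range by blast
      show "E \<subseteq> {(a, b) \<in> pos ` \<Union>A \<times> pos ` \<Union>A. a < b}"
        by (auto simp: E_def Arc_def)
      fix a b c d assume "(a, b) \<in> E" "(c, d) \<in> E"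
      then obtain v w x y where vw: "(v, w) \<in> Arc A" "a = pos v" "b = pos w"
        and xy: "(x, y) \<in> Arc A" "c = pos x" "d = pos y"
        by (auto simp: E_def)
      show "\<not> (a < c \<and> c < b \<and> b < d)"
      proof
        assume lt: "a < c \<and> c < b \<and> b < d"
        have "{v, w} \<inter> {x, y} = {}" using lt vw xy by auto
        moreover have "(v, w) \<in> r" "(x, y) \<in> r" "(v, x) \<in> r" "(x, w) \<in> r" "(w, y) \<in> r"
          using lt vw xy ArcA pos_iff by auto
        ultimately have "crossing r {v, w} {x, y}"
          unfolding crossing_def by blast
        with pages[OF A] vw xy show False by (auto simp: page_def Arc_def)
      qed
    qed
    also have "card (pos ` \<Union>A) = card (\<Union>A)"
      using sub inj by (simp add: card_image inj_on_subset)
    finally show ?thesis .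
  qed
  have finP: "finite P"
    using P finite_elements finite_imp_finite_nsets[of "{..<n}" 2] by blast
  have subP: "\<Union>A \<subseteq> {..<n}" if "A \<in> P" for A
    using that P by (auto simp: partition_on_def nsets_def)
  have finArc: "finite (Arc A)" if "A \<in> P" for A
    by (rule finite_subset[of _ "{..<n} \<times> {..<n}"]) (use subP[OF that] in \<open>auto simp: Arc_def\<close>)
  define S where "S = {(x, y). x < n \<and> y < n \<and> pos x < pos y}"
  have finS: "finite S"
    by (rule finite_subset[of _ "{..<n} \<times> {..<n}"]) (auto simp: S_def)
  have SU: "S = (\<Union>A\<in>P. Arc A)"
  proof -
    have "(x, y) \<in> S \<longleftrightarrow> {x, y} \<in> \<Union>P \<and> pos x < pos y" for x y
      using P by (auto simp: S_def partition_on_def)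
    then show ?thesis by (auto simp: Arc_def)
  qed
  have disj: "Arc A \<inter> Arc B = {}" if "A \<in> P" "B \<in> P" "A \<noteq> B" for A B
    using P that by (auto simp: partition_on_def disjoint_def Arc_def)
  have "(\<Sum>(x, y)\<in>S. W (dist x y)) = (\<Sum>A\<in>P. \<Sum>(x, y)\<in>Arc A. W (dist x y))"
    unfolding SU by (rule sum.UNION_disjoint) (use finP finArc disj in auto)
  also have "\<dots> \<le> (\<Sum>A\<in>P. q * card (\<Union>A))"
    by (intro sum_mono page_bound)
  also have "\<dots> = q * (\<Sum>A\<in>P. \<Sum>v\<in>{..<n}. if v \<in> \<Union>A then 1 else 0)"
  proof -
    have "card (\<Union>A) = (\<Sum>v\<in>{..<n}. if v \<in> \<Union>A then 1 else 0)" if "A \<in> P" for A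
    proof -
      have "{..<n} \<inter> {v. v \<in> \<Union>A} = \<Union>A" using subP[OF that] by blast
      then show ?thesis by (simp only: sum.If_cases finite_lessThan) simp
    qed
    then show ?thesis by (simp add: sum_distrib_left[symmetric])
  qed
  also have "\<dots> = q * (\<Sum>v\<in>{..<n}. \<Sum>A\<in>P. if v \<in> \<Union>A then 1 else 0)"
    by (subst sum.swap) simp
  also have "\<dots> \<le> q * (\<Sum>v\<in>{..<n}. k)"
  proof (intro mult_le_mono2 sum_mono)
    fix v assume "v \<in> {..<n}"
    then have "card {A \<in> P. v \<in> \<Union>A} \<le> k"
      using k by (auto simp: k_local_def complete_graph_def incident_edges_nonempty_iff)
    then show "(\<Sum>A\<in>P. if v \<in> \<Union>A then 1 else 0) \<le> k"
      using finP by (simp add: sum.If_cases Int_def)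
  qed
  finally have upper: "(\<Sum>(x, y)\<in>S. W (dist x y)) \<le> q * n * k" by simp
  \<comment> \<open>Each edge is seen from both of its endpoints, and every vertex sees the same circle of distances.\<close>
  have "(\<Sum>x\<in>{..<n}. \<Sum>y\<in>{..<n} - {x}. W (dist x y)) = (\<Sum>(x, y)\<in>S \<union> prod.swap ` S. W (dist x y))"
  proof -
    have "S \<union> prod.swap ` S = (SIGMA x:{..<n}. {..<n} - {x})"
      using inj_onD[OF inj] by (auto simp: S_def image_iff) (metis lessThan_iff linorder_neqE_nat)
    then show ?thesis by (simp add: sum.Sigma)
  qed
  also have "\<dots> = (\<Sum>(x, y)\<in>S. W (dist x y)) + (\<Sum>(x, y)\<in>prod.swap ` S. W (dist x y))"
    using finS by (intro sum.union_disjoint) (auto simp: S_def)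
  also have "(\<Sum>(x, y)\<in>prod.swap ` S. W (dist x y)) = (\<Sum>(x, y)\<in>S. W (dist x y))"
    by (subst sum.reindex) (auto simp: S_def dist_def intro!: sum.cong)
  finally have double: "(\<Sum>x\<in>{..<n}. \<Sum>y\<in>{..<n} - {x}. W (dist x y)) = 2 * (\<Sum>(x, y)\<in>S. W (dist x y))"
    by simp
  have "(\<Sum>y\<in>{..<n} - {x}. W (dist x y)) = (\<Sum>d\<in>{1..<n}. W d)" if x: "x < n" for x
  proof -
    have "(\<Sum>d\<in>{1..<n}. W d) = (\<Sum>b\<in>{..<n} - {pos x}. W (if pos x < b then b - pos x else pos x - b))"
      using x range by (intro sum_over_circle[symmetric]) (auto simp: W_def)
    also have "\<dots> = (\<Sum>y\<in>{..<n} - {x}. W (dist x y))"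
    proof -
      have "bij_betw pos ({..<n} - {x}) ({..<n} - {pos x})"
        using bij x by (intro bij_betw_DiffI) (auto simp: bij_betw_def)
      from sum.reindex_bij_betw[OF this, of "\<lambda>b. W (if pos x < b then b - pos x else pos x - b)"]
      show ?thesis by (simp add: dist_def)
    qed
    finally show ?thesis ..
  qed
  then have "(\<Sum>x\<in>{..<n}. \<Sum>y\<in>{..<n} - {x}. W (dist x y)) = n * (\<Sum>d\<in>{1..<n}. W d)"
    by simp
  with double upper have "n * (\<Sum>d\<in>{1..<n}. W d) \<le> 2 * (q * n * k)" by simp
  then have "(\<Sum>d\<in>{1..<n}. W d) \<le> 2 * q * k" using n(1) by simp
  then have "int (\<Sum>d\<in>{1..<n}. W d) \<le> int q * (2 * int k)"
    by (metis mult.assoc mult.commute of_nat_le_iff of_nat_mult of_nat_numeral)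
  moreover have "int q * (int n - int q) \<le> int (\<Sum>d\<in>{1..<n}. W d)"
    using sum_truncated_cyclic_distance[of q n] by (simp add: W_def)
  ultimately have "int q * (int n - int q) \<le> int q * (2 * int k)" by linarith
  then show ?thesis using n(2) by (simp add: k_def)
qed

section \<open>Local book embeddings from rotated hexagons\<close>

text \<open>
  The triangulated polygon on \<open>v\<close> and the vertices at clockwise distances \<open>D\<close> from \<open>v\<close> on the
  circle \<open>{..<n}\<close>, with all diagonals at \<open>v\<close>: its edges are the spokes (\<open>a = 0\<close>) and the
  sides joining consecutive members of \<open>D\<close>.
\<close>

definition fan :: "nat \<Rightarrow> nat \<Rightarrow> nat set \<Rightarrow> nat set set" where
  "fan n v D = {{(v + a) mod n, (v + b) mod n} | a b.
     a \<in> insert 0 D \<and> b \<in> D \<and> a < b \<and> (a = 0 \<or> (\<forall>c\<in>D. \<not> (a < c \<and> c < b)))}"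

text \<open>
  Measured by clockwise distance \<open>\<rho>\<close> from the apex, two crossing edges would have one endpoint
  strictly inside an edge that avoids the apex, but such an edge is a side and has no vertex of the
  fan inside. Crossing on the circle does not depend on where the circle is cut open, so it suffices
  to compare the positions of the four endpoints with that of the apex.
\<close>

lemma page_fan:
  assumes v: "v < n" and D: "D \<subseteq> {..<n}"
  shows "page (natural_order n) (fan n v D)"
proof -
  define \<rho> where "\<rho> x = (if v \<le> x then x - v else x + n - v)" for x
  have \<rho>: "\<rho> ((v + a) mod n) = a" if "a < n" for a
    using v that by (auto simp: \<rho>_def mod_if)
  have fan_edge: "\<exists>a b. {\<rho> x, \<rho> y} = {a, b} \<and> a \<in> insert 0 D \<and> b \<in> D \<and> a < b
      \<and> (a = 0 \<or> (\<forall>c\<in>D. \<not> (a < c \<and> c < b)))"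
    if e: "{x, y} \<in> fan n v D" for x y
  proof -
    obtain a b where ab: "{x, y} = {(v + a) mod n, (v + b) mod n}" "a \<in> insert 0 D" "b \<in> D" "a < b"
        "a = 0 \<or> (\<forall>c\<in>D. \<not> (a < c \<and> c < b))"
      using e by (auto simp: fan_def)
    have "a < n" "b < n" using ab D v by auto
    have "{\<rho> x, \<rho> y} = \<rho> ` {x, y}" by simp
    also have "\<dots> = {a, b}" using ab(1) \<rho> \<open>a < n\<close> \<open>b < n\<close> by simp
    finally show ?thesis using ab by blast
  qed
  have straddle: False
    if e: "{x, y} \<in> fan n v D" and f: "{z, w} \<in> fan n v D"
      and lt: "\<rho> x < \<rho> z" "\<rho> z < \<rho> y" "\<rho> y < \<rho> w" for x y z w
  proof -
    have "\<rho> y \<in> D" using fan_edge[OF e] lt by (auto simp: doubleton_eq_iff)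
    then show False using fan_edge[OF f] lt by (auto simp: doubleton_eq_iff)
  qed
  have noncross: False
    if e: "{a, b} \<in> fan n v D" and f: "{c, d} \<in> fan n v D" and lt: "a < c" "c < b" "b < d" "d < n" for a b c d
  proof -
    have e': "{b, a} \<in> fan n v D" and f': "{d, c} \<in> fan n v D"
      using e f by (simp_all add: insert_commute)
    consider "v \<le> a" | "a < v" "v \<le> c" | "c < v" "v \<le> b" | "b < v" "v \<le> d" | "d < v"
      using lt by linarith
    then show False
    proof cases
      case 1 then show False
        by (intro straddle[OF e f]) (use lt v in \<open>auto simp: \<rho>_def\<close>)
    next
      case 2 then show False
        by (intro straddle[OF f e']) (use lt v in \<open>auto simp: \<rho>_def\<close>)
    next
      case 3 then show False
        by (intro straddle[OF e' f']) (use lt v in \<open>auto simp: \<rho>_def\<close>)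
    next
      case 4 then show False
        by (intro straddle[OF f' e]) (use lt v in \<open>auto simp: \<rho>_def\<close>)
    next
      case 5 then show False
        by (intro straddle[OF e f]) (use lt v in \<open>auto simp: \<rho>_def\<close>)
    qed
  qed
  show ?thesis
    unfolding page_def
  proof (intro ballI notI)
    fix e f assume ef: "e \<in> fan n v D" "f \<in> fan n v D" "crossing (natural_order n) e f"
    from ef(3) obtain a b c d where "e = {a, b} \<and> f = {c, d} \<or> e = {c, d} \<and> f = {a, b}"
        "a < c" "c < b" "b < d" "d < n"
      by (rule crossing_natural_orderE)
    with noncross ef(1,2) show False by blast
  qed
qed

text \<open>
  The clockwise distances from the apex to the other five vertices of the \<open>i\<close>-th hexagon on a
  circle of \<open>18 * N\<close> vertices. The six sides have the lengths \<open>6N - i\<close>, \<open>2i\<close>,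
  \<open>4N - 2i\<close>, \<open>2i + 1\<close>, \<open>4N - 2i - 1\<close> and \<open>4N + i\<close>, the three diagonals at the apex have the
  lengths \<open>6N + i\<close>, \<open>8N + i\<close> and \<open>8N - i - 1\<close>. They are chosen for equality in the lower bound, where sides
  must have length at most a third of the circle and diagonals at least that.
\<close>

definition hexagon :: "nat \<Rightarrow> nat \<Rightarrow> nat set" where
  "hexagon N i = {6 * N - i, 6 * N + i, 10 * N - i, 10 * N + i + 1, 14 * N - i}"

lemma fan_chord:
  assumes xy: "x < y" "y < n" and ab: "a \<in> insert 0 D" "b \<in> D" "a < b" "b < n"
    and consec: "a = 0 \<or> (\<forall>c\<in>D. \<not> (a < c \<and> c < b))"
    and len: "b - a = y - x \<or> b - a = n - (y - x)"
  shows "\<exists>v<n. {x, y} \<in> fan n v D"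
proof -
  have fanI: "{(v + a) mod n, (v + b) mod n} \<in> fan n v D" for v
    using ab consec by (auto simp: fan_def)
  show ?thesis
    using len
  proof
    assume len: "b - a = y - x"
    define v where "v = (x + n - a) mod n"
    have "(v + a) mod n = x" "(v + b) mod n = (x + n + (b - a)) mod n"
      using xy ab by (simp_all add: v_def mod_simps)
    moreover have "(x + n + (b - a)) mod n = y"
      using xy len by (simp add: add.commute[of _ n] add.assoc)
    ultimately show ?thesis using fanI[of v] xy by (intro exI[of _ v]) (simp add: v_def)
  next
    assume len: "b - a = n - (y - x)"
    define v where "v = (y + n - a) mod n"
    have "(v + a) mod n = y" "(v + b) mod n = (y + n + (b - a)) mod n"
      using xy ab by (simp_all add: v_def mod_simps)
    moreover have "y + n + (b - a) = x + n + n"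
      using xy len by simp
    ultimately show ?thesis using fanI[of v] xy
      by (intro exI[of _ v]) (simp add: v_def insert_commute)
  qed
qed

text \<open>
  While \<open>i\<close> runs from 0 to \<open>N\<close>, the nine lengths above exhaust all lengths up to half the circle.
  Without the shift by 1 in \<open>10 * N + i + 1\<close>, the sides of lengths \<open>2i\<close> and \<open>4N - 2i\<close>
  would occur twice and the odd lengths below \<open>4N\<close> not at all.
\<close>

lemma hexagon_chords:
  assumes d: "0 < d" "d < 18 * N"
  shows "\<exists>i\<le>N. \<exists>a b. a \<in> insert 0 (hexagon N i) \<and> b \<in> hexagon N i \<and> a < b \<and>
     (a = 0 \<or> (\<forall>c\<in>hexagon N i. \<not> (a < c \<and> c < b))) \<and> (b - a = d \<or> b - a = 18 * N - d)"
proof -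
  define m where "m = min d (18 * N - d)"
  have m: "0 < m" "m \<le> 9 * N" using d by (auto simp: m_def)
  have goal: ?thesis
    if "i \<le> N" "a \<in> insert 0 (hexagon N i)" "b \<in> hexagon N i" "a < b"
      "a = 0 \<or> (\<forall>c\<in>hexagon N i. \<not> (a < c \<and> c < b))" "b - a = m \<or> b - a = 18 * N - m" for i a b
  proof -
    have "b - a = d \<or> b - a = 18 * N - d" using that(6) d unfolding m_def by linarith
    with that show ?thesis by blast
  qed
  have N: "0 < N" using d by auto
  \<comment> \<open>One case for each of the nine edges of a hexagon.\<close>
  consider "m \<le> 2 * N" "even m" | "m \<le> 2 * N" "odd m" | "2 * N < m" "m \<le> 4 * N" "even m"
    | "2 * N < m" "m \<le> 4 * N" "odd m" | "4 * N < m" "m \<le> 5 * N" | "5 * N < m" "m \<le> 6 * N"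
    | "6 * N < m" "m \<le> 7 * N" | "7 * N < m" "m < 8 * N" | "8 * N \<le> m"
    by linarith
  then show ?thesis
  proof cases
    case 1
    then obtain i where i: "m = 2 * i" by (elim evenE)
    show ?thesis by (rule goal[of i "6 * N - i" "6 * N + i"]) (use i 1 m N in \<open>auto simp: hexagon_def\<close>)
  next
    case 2
    then obtain i where i: "m = 2 * i + 1" by (elim oddE)
    show ?thesis
      by (rule goal[of i "10 * N - i" "10 * N + i + 1"]) (use i 2 m N in \<open>auto simp: hexagon_def\<close>)
  next
    case 3
    then obtain j where j: "m = 2 * j" by (elim evenE)
    show ?thesis
      by (rule goal[of "2 * N - j" "6 * N + (2 * N - j)" "10 * N - (2 * N - j)"])
        (use j 3 m N in \<open>auto simp: hexagon_def\<close>)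
  next
    case 4
    then obtain j where j: "m = 2 * j + 1" by (elim oddE)
    show ?thesis
      by (rule goal[of "2 * N - j - 1" "10 * N + (2 * N - j - 1) + 1" "14 * N - (2 * N - j - 1)"])
        (use j 4 m N in \<open>auto simp: hexagon_def\<close>)
  next
    case 5
    show ?thesis
      by (rule goal[of "m - 4 * N" 0 "14 * N - (m - 4 * N)"]) (use 5 m N in \<open>auto simp: hexagon_def\<close>)
  next
    case 6
    show ?thesis
      by (rule goal[of "6 * N - m" 0 "6 * N - (6 * N - m)"]) (use 6 m N in \<open>auto simp: hexagon_def\<close>)
  next
    case 7
    show ?thesis
      by (rule goal[of "m - 6 * N" 0 "6 * N + (m - 6 * N)"]) (use 7 m N in \<open>auto simp: hexagon_def\<close>)
  next
    case 8
    show ?thesis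
      by (rule goal[of "8 * N - 1 - m" 0 "10 * N + (8 * N - 1 - m) + 1"])
        (use 8 m N in \<open>auto simp: hexagon_def\<close>)
  next
    case 9
    show ?thesis
      by (rule goal[of "m - 8 * N" 0 "10 * N - (m - 8 * N)"]) (use 9 m N in \<open>auto simp: hexagon_def\<close>)
  qed
qed

text \<open>
  All rotations of all \<open>N + 1\<close> hexagons cover every edge of the circle, and for each hexagon a
  vertex lies in exactly the rotations that put one of the six corners there. Restricting to
  the first \<open>n\<close> vertices handles numbers that are not multiples of 18.
\<close>

lemma local_page_number_complete_graph_le:
  assumes n: "n \<le> 18 * N" and N: "0 < N"
  shows "local_page_number (complete_graph n) \<le> 6 * (N + 1)"
proof -
  define F where "F = (\<lambda>(v, i). {e \<in> fan (18 * N) v (hexagon N i). e \<subseteq> {..<n}})"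
  define J where "J = {..<18 * N} \<times> {..N}"
  have hex: "hexagon N i \<subseteq> {..<18 * N}" "card (insert 0 (hexagon N i)) \<le> 6" if "i \<le> N" for i
  proof -
    show "hexagon N i \<subseteq> {..<18 * N}" using that N by (auto simp: hexagon_def)
    show "card (insert 0 (hexagon N i)) \<le> 6"
      using card_insert_le_m1 unfolding hexagon_def by (simp add: card_insert_if)
  qed
  show ?thesis
  proof (rule local_page_number_le_cover[OF vertex_ordering_natural_order, where J = J and F = F])
    show "finite J" by (simp add: J_def)
    show "page (natural_order n) (F j)" if j: "j \<in> J" for j
    proof -
      obtain v i where vi: "j = (v, i)" "v < 18 * N" "i \<le> N" using j by (auto simp: J_def)
      have "page (natural_order (18 * N)) (fan (18 * N) v (hexagon N i))"
        using page_fan hex(1) vi by blast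
      then have "page (natural_order (18 * N)) (F j)"
        by (rule page_subset) (auto simp: F_def vi)
      then show ?thesis
        using n unfolding page_def crossing_def natural_order_def by (smt (verit) case_prodI mem_Collect_eq case_prodD order_less_le_trans)
    qed
    show "\<exists>j\<in>J. e \<in> F j" if e: "e \<in> edges (complete_graph n)" for e
    proof -
      obtain x y where xy: "e = {x, y}" "x < y" "y < n" using complete_graph_edgeE[OF e] .
      have "0 < y - x" "y - x < 18 * N" using xy n by auto
      from hexagon_chords[OF this] obtain i a b where i: "i \<le> N" and ab: "a \<in> insert 0 (hexagon N i)" "b \<in> hexagon N i" "a < b"
          "a = 0 \<or> (\<forall>c\<in>hexagon N i. \<not> (a < c \<and> c < b))" "b - a = y - x \<or> b - a = 18 * N - (y - x)"
        by blast
      moreover have "b < 18 * N" using hex(1)[OF i] ab(2) by auto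
      ultimately obtain v where "v < 18 * N" "{x, y} \<in> fan (18 * N) v (hexagon N i)"
        using fan_chord[of x y "18 * N" a "hexagon N i" b] xy n by auto
      then show ?thesis using i xy by (intro bexI[of _ "(v, i)"]) (auto simp: F_def J_def)
    qed
    fix u assume "u \<in> verts (complete_graph n)"
    then have u: "u < 18 * N" using n by (simp add: complete_graph_def)
    define I where "I = (SIGMA i:{..N}. insert 0 (hexagon N i))"
    have "finite I" by (auto simp: I_def hexagon_def)
    have "{j \<in> J. u \<in> \<Union>(F j)} \<subseteq> (\<lambda>(i, a). ((u + 18 * N - a) mod (18 * N), i)) ` I"
    proof (rule subsetI)
      fix j assume j: "j \<in> {j \<in> J. u \<in> \<Union>(F j)}"
      then obtain v i where vi: "j = (v, i)" "v < 18 * N" "i \<le> N" by (auto simp: J_def)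
      from j obtain a where a: "a \<in> insert 0 (hexagon N i)" "u = (v + a) mod (18 * N)"
        unfolding vi F_def fan_def by auto
      have "a < 18 * N" using a hex(1)[OF vi(3)] N by auto
      then have "(u + 18 * N - a) mod (18 * N) = v"
        using a(2) vi(2) by (auto simp: mod_if)
      then show "j \<in> (\<lambda>(i, a). ((u + 18 * N - a) mod (18 * N), i)) ` I"
        using vi a by (intro image_eqI[of _ _ "(i, a)"]) (auto simp: I_def)
    qed
    then have "card {j \<in> J. u \<in> \<Union>(F j)} \<le> card I"
      using \<open>finite I\<close> surj_card_le by blast
    also have "\<dots> = (\<Sum>i\<in>{..N}. card (insert 0 (hexagon N i)))"
      unfolding I_def by (intro card_SigmaI) (auto simp: hexagon_def)
    also have "\<dots> \<le> (\<Sum>i\<in>{..N}. 6)"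
      by (intro sum_mono hex(2)) simp
    finally show "card {j \<in> J. u \<in> \<Union>(F j)} \<le> 6 * (N + 1)" by simp
  qed
qed

section \<open>Union pages from blow-ups\<close>

text \<open>
  A cover of the complete graph on \<open>{..<n}\<close>, ordered naturally, by \<open>k\<close> union pages: \<open>U j\<close> is the
  edge relation of the \<open>j\<close>-th one and \<open>\<kappa> j\<close> names its vertex-disjoint pages. Working with
  covers instead of partitions makes the notion monotone and convenient for recursion.
\<close>

definition union_page_labelling ::
    "nat \<Rightarrow> nat \<Rightarrow> (nat \<Rightarrow> nat \<Rightarrow> nat \<Rightarrow> bool) \<Rightarrow> (nat \<Rightarrow> nat \<Rightarrow> nat) \<Rightarrow> bool" where
  "union_page_labelling n k U \<kappa> \<longleftrightarrow>
     (\<forall>x y. x < y \<longrightarrow> y < n \<longrightarrow> (\<exists>j<k. U j x y)) \<and>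
     (\<forall>j x y. x < y \<longrightarrow> y < n \<longrightarrow> U j x y \<longrightarrow> \<kappa> j x = \<kappa> j y) \<and>
     (\<forall>j a b c d. a < c \<longrightarrow> c < b \<longrightarrow> b < d \<longrightarrow> d < n \<longrightarrow> U j a b \<longrightarrow> U j c d \<longrightarrow> \<kappa> j a \<noteq> \<kappa> j c)"

definition union_coverable :: "nat \<Rightarrow> nat \<Rightarrow> bool" where
  "union_coverable n k \<longleftrightarrow> (\<exists>U \<kappa>. union_page_labelling n k U \<kappa>)"

lemma union_page_labellingD:
  assumes "union_page_labelling n k U \<kappa>"
  shows "x < y \<Longrightarrow> y < n \<Longrightarrow> \<exists>j<k. U j x y"
    and "x < y \<Longrightarrow> y < n \<Longrightarrow> U j x y \<Longrightarrow> \<kappa> j x = \<kappa> j y"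
    and "a < c \<Longrightarrow> c < b \<Longrightarrow> b < d \<Longrightarrow> d < n \<Longrightarrow> U j a b \<Longrightarrow> U j c d \<Longrightarrow> \<kappa> j a \<noteq> \<kappa> j c"
  using assms unfolding union_page_labelling_def by simp_all

lemma union_page_number_le_of_coverable:
  assumes "union_coverable n k"
  shows "union_page_number (complete_graph n) \<le> k"
proof -
  obtain U \<kappa> where L: "union_page_labelling n k U \<kappa>"
    using assms unfolding union_coverable_def by blast
  note cover = union_page_labellingD(1)[OF L]
    and const = union_page_labellingD(2)[OF L]
    and sep = union_page_labellingD(3)[OF L]
  define F where "F j = {e. \<exists>x y. e = {x, y} \<and> x < y \<and> y < n \<and> U j x y}" for j
  have F: "U j x y" if "{x, y} \<in> F j" "x < y" for j x y
    using that by (auto simp: F_def doubleton_eq_iff)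
  have const': "\<kappa> j x = \<kappa> j y" if "e \<in> F j" "x \<in> e" "y \<in> e" for e j x y
    using that const by (auto simp: F_def)
  have "union_page_number (complete_graph n) \<le> card {..<k}"
  proof (rule union_page_number_le_cover[OF vertex_ordering_natural_order, where F = F])
    show "union_page (natural_order n) (F j)" for j
    proof (rule union_page_if_labelled[where \<kappa> = "\<kappa> j", OF const'])
      fix e f x y
      assume ef: "e \<in> F j" "f \<in> F j" and cr: "crossing (natural_order n) e f" and xy: "x \<in> e" "y \<in> f"
      obtain a b c d where e: "e = {a, b} \<and> f = {c, d} \<or> e = {c, d} \<and> f = {a, b}"
        and lt: "a < c" "c < b" "b < d" "d < n"
        using crossing_natural_orderE[OF cr] .
      have "{a, b} \<in> F j" "{c, d} \<in> F j" using e ef by auto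
      then have "\<kappa> j a \<noteq> \<kappa> j c" using F sep lt by (meson order_less_trans)
      moreover have "\<kappa> j x = \<kappa> j a \<and> \<kappa> j y = \<kappa> j c \<or> \<kappa> j x = \<kappa> j c \<and> \<kappa> j y = \<kappa> j a"
        using e const'[OF ef(1) xy(1)] const'[OF ef(2) xy(2)] by auto
      ultimately show "\<kappa> j x \<noteq> \<kappa> j y" by auto
    qed
    show "\<exists>j\<in>{..<k}. e \<in> F j" if e: "e \<in> edges (complete_graph n)" for e
    proof -
      obtain x y where xy: "e = {x, y}" "x < y" "y < n" using complete_graph_edgeE[OF e] .
      with cover[of x y] obtain j where "j < k" "U j x y" by blast
      with xy show ?thesis by (auto simp: F_def)
    qed
  qed simp
  then show ?thesis by simp
qed

lemma union_coverable_mono: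
  assumes "union_coverable n k" "n' \<le> n" "k \<le> k'"
  shows "union_coverable n' k'"
proof -
  obtain U \<kappa> where L: "union_page_labelling n k U \<kappa>"
    using assms(1) unfolding union_coverable_def by blast
  note U = union_page_labellingD[OF L]
  have n': "y < n" if "y < n'" for y using that assms(2) by simp
  show ?thesis
    unfolding union_coverable_def union_page_labelling_def
  proof (intro exI[of _ U] exI[of _ \<kappa>] conjI allI impI)
    show "\<exists>j<k'. U j x y" if "x < y" "y < n'" for x y
      using U(1)[OF that(1) n'[OF that(2)]] assms(3) order_less_le_trans by blast
  qed (use U(2,3) n' in blast)+
qed

lemma union_coverable_square: "union_coverable n (n * n)"
  unfolding union_coverable_def union_page_labelling_def
proof (intro exI[of _ "\<lambda>j x y. j = x * n + y"] exI[of _ "\<lambda>j x. 0"] conjI allI impI)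
  fix x y assume "x < y" "y < n"
  then have "x * n + y < Suc x * n" by simp
  also have "\<dots> \<le> n * n" using \<open>x < y\<close> \<open>y < n\<close> by (intro mult_le_mono1) simp
  finally show "\<exists>j<n * n. j = x * n + y" by blast
next
  fix j a b c d assume "a < c" "c < b" "b < d" "d < n" "j = a * n + b" "j = c * n + d"
  then have "a * n + b = c * n + d" "Suc a * n \<le> c * n" by (simp_all only: mult_le_mono1 Suc_leI)
  then show "(0::nat) \<noteq> 0" using \<open>b < d\<close> by simp
qed simp

text \<open>
  The complete graph on eight vertices in three union pages. Pair each vertex \<open>i < 4\<close> with its
  antipode \<open>i + 4\<close>. Each of the three perfect matchings of \<open>{0, 1, 2, 3}\<close> splits the
  eight vertices into two groups of two antipodal pairs, and such a group spans a noncrossing 4-cycle.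
  These cycles contain all edges except the four antipodal ones, and these fit into four different
  groups, one diagonal each. In the tables the row is the union page and the column is the vertex;
  the edges of a union page join vertices of the same group with different slopes.

  The slopes colour each group properly, with values \<open>1\<close> and \<open>2\<close> at the ends of a diagonal.
  They control how labels are shifted between the copies of a group in a blow-up.
\<close>

definition octagon_group :: "nat \<Rightarrow> nat \<Rightarrow> nat" where
  "octagon_group p u = [[0, 0, 1, 1, 0, 0, 1, 1], [0, 1, 0, 1, 0, 1, 0, 1], [0, 1, 1, 0, 0, 1, 1, 0]] ! p ! u"

definition octagon_slope :: "nat \<Rightarrow> nat \<Rightarrow> nat" where
  "octagon_slope p u = [[1, 0, 1, 0, 2, 0, 2, 0], [0, 0, 1, 1, 0, 0, 1, 1], [0, 1, 0, 1, 0, 2, 0, 2]] ! p ! u"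

lemma octagon_covered:
  assumes "u < w" "w < 8"
  obtains p where "p < 3" "octagon_group p u = octagon_group p w" "octagon_slope p u \<noteq> octagon_slope p w"
proof -
  have "\<forall>w\<in>set [0..<8]. \<forall>u\<in>set [0..<w]. \<exists>p\<in>set [0..<3].
      octagon_group p u = octagon_group p w \<and> octagon_slope p u \<noteq> octagon_slope p w"
    by code_simp
  moreover have "w \<in> set [0..<8]" "u \<in> set [0..<w]" using assms by auto
  ultimately obtain p where "p \<in> set [0..<3]"
      "octagon_group p u = octagon_group p w" "octagon_slope p u \<noteq> octagon_slope p w"
    by blast
  then show thesis using that[of p] by simp
qed

lemma octagon_noncrossing:
  assumes "p < 3" "u1 < u2" "u2 < u3" "u3 < u4" "u4 < 8"
    and "octagon_group p u1 = octagon_group p u2" "octagon_group p u2 = octagon_group p u3"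
      "octagon_group p u3 = octagon_group p u4"
  shows "octagon_slope p u1 = octagon_slope p u3 \<or> octagon_slope p u2 = octagon_slope p u4"
proof -
  have "\<forall>p\<in>set [0..<3]. \<forall>u4\<in>set [0..<8]. \<forall>u3\<in>set [0..<u4]. \<forall>u2\<in>set [0..<u3]. \<forall>u1\<in>set [0..<u2].
      octagon_group p u1 = octagon_group p u2 \<longrightarrow> octagon_group p u2 = octagon_group p u3 \<longrightarrow>
      octagon_group p u3 = octagon_group p u4 \<longrightarrow>
      octagon_slope p u1 = octagon_slope p u3 \<or> octagon_slope p u2 = octagon_slope p u4"
    by code_simp
  with assms show ?thesis by simp
qed

lemma octagon_slope_le:
  assumes "p < 3" "u < 8"
  shows "octagon_slope p u \<le> 2"
proof -
  have "\<forall>p\<in>set [0..<3]. \<forall>u\<in>set [0..<8]. octagon_slope p u \<le> 2" by code_simp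
  with assms show ?thesis by simp
qed

text \<open>
  Replace each of the eight vertices by a block of \<open>M\<close> consecutive ones. For a union page \<open>p\<close> and a
  parameter \<open>t\<close>, take \<open>M\<close> disjoint copies of each group: copy \<open>s\<close> uses in block
  \<open>u\<close> the vertex with residue \<open>s + slope u * t\<close> modulo \<open>M\<close>. As every copy has a single vertex in
  each of its blocks, the order is that of the blocks and the copy inherits the absence of
  crossings. An edge between two blocks lies in the copies for exactly one \<open>t\<close>, since the difference
  of two slopes is \<open>1\<close> or \<open>2\<close> up to sign and thus invertible modulo the odd number \<open>M\<close>. The
  edges inside the blocks are covered simultaneously in all blocks by \<open>g\<close> further union pages.
\<close>

lemma union_coverable_blowup:
  assumes g: "union_coverable M g" and M: "odd M"
  shows "union_coverable (8 * M) (3 * M + g)"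
proof -
  have M0: "0 < M" using M by (rule odd_pos)
  obtain U \<kappa> where L: "union_page_labelling M g U \<kappa>"
    using g unfolding union_coverable_def by blast
  note cover = union_page_labellingD(1)[OF L]
    and const = union_page_labellingD(2)[OF L]
    and sep = union_page_labellingD(3)[OF L]
  \<comment> \<open>The number of the copy that contains a vertex; union page p with parameter t has the index p * M + t.\<close>
  define copy where "copy p t v = nat ((int (v mod M) - int (octagon_slope p (v div M)) * int t) mod int M)"
    for p t v
  have copy_eq_iff: "copy p t v = copy p t w \<longleftrightarrow>
      [int (v mod M) - int (octagon_slope p (v div M)) * int t
       = int (w mod M) - int (octagon_slope p (w div M)) * int t] (mod int M)" for p t v w
    using M0 by (simp add: copy_def cong_def eq_nat_nat_iff)
  define lab where "lab j v = (if j < 3 * M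
      then prod_encode (octagon_group (j div M) (v div M), copy (j div M) (j mod M) v)
      else prod_encode (v div M, \<kappa> (j - 3 * M) (v mod M)))" for j v
  define U' where "U' j v w = (if j < 3 * M
      then lab j v = lab j w \<and> octagon_slope (j div M) (v div M) \<noteq> octagon_slope (j div M) (w div M)
      else v div M = w div M \<and> U (j - 3 * M) (v mod M) (w mod M))" for j v w
  have mod_less: "v mod M < w mod M" if "v < w" "v div M = w div M" for v w
  proof -
    have "v = w div M * M + v mod M"
      using div_mult_mod_eq[of v M] that(2) by simp
    moreover have "w = w div M * M + w mod M" by simp
    ultimately show ?thesis using that(1) by linarith
  qed
  show ?thesis
    unfolding union_coverable_def union_page_labelling_def
  proof (intro exI[of _ U'] exI[of _ lab] conjI allI impI)
    fix v w assume vw: "v < w" "w < 8 * M"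
    then have blocks: "v div M \<le> w div M" "w div M < 8"
      by (auto simp: div_le_mono less_mult_imp_div_less)
    show "\<exists>j<3 * M + g. U' j v w"
    proof (cases "v div M = w div M")
      case True
      with cover[OF mod_less[OF vw(1) True]] M0 obtain j where "j < g" "U j (v mod M) (w mod M)" by auto
      with True show ?thesis by (intro exI[of _ "3 * M + j"]) (simp add: U'_def)
    next
      case False
      with blocks have "v div M < w div M" by simp
      then obtain p where p: "p < 3" "octagon_group p (v div M) = octagon_group p (w div M)"
          "octagon_slope p (v div M) \<noteq> octagon_slope p (w div M)"
        using octagon_covered blocks by blast
      \<comment> \<open>Solve for the parameter t whose copies contain the edge.\<close>
      define \<delta> where "\<delta> = int (octagon_slope p (w div M)) - int (octagon_slope p (v div M))"
      have "octagon_slope p (w div M) \<le> 2" "octagon_slope p (v div M) \<le> 2"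
        using octagon_slope_le p(1) blocks by simp_all
      then have "\<delta> \<in> {-2, -1, 1, 2}" using p(3) unfolding \<delta>_def by auto
      moreover have "coprime 2 (int M)" using M by simp
      ultimately have "coprime \<delta> (int M)" by auto
      then obtain s where s: "[\<delta> * s = 1] (mod int M)" using cong_solve_coprime_int by blast
      define e where "e = int (w mod M) - int (v mod M)"
      define t where "t = nat ((s * e) mod int M)"
      have t: "int t = (s * e) mod int M" "t < M" using M0 by (simp_all add: t_def nat_less_iff)
      have "[\<delta> * int t = \<delta> * (s * e)] (mod int M)"
        by (simp add: t cong_def mod_simps)
      also have "[\<delta> * (s * e) = e] (mod int M)"
        using cong_scalar_right[OF s, of e] by (simp add: mult.assoc)
      finally have "[\<delta> * int t = e] (mod int M)" .
      then have "[int (w mod M) - int (octagon_slope p (w div M)) * int t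
          = int (v mod M) - int (octagon_slope p (v div M)) * int t] (mod int M)"
        unfolding cong_iff_dvd_diff \<delta>_def e_def by (simp add: algebra_simps dvd_diff_commute)
      then have "copy p t v = copy p t w"
        by (simp add: copy_eq_iff cong_sym_eq)
      moreover have "p * M + t < 3 * M"
      proof -
        have "p * M + t < Suc p * M" using t(2) by simp
        also have "\<dots> \<le> 3 * M" using p(1) by (intro mult_le_mono1) simp
        finally show ?thesis .
      qed
      moreover have "(p * M + t) div M = p" "(p * M + t) mod M = t"
        using t(2) by simp_all
      ultimately show ?thesis
        using p by (intro exI[of _ "p * M + t"]) (simp add: U'_def lab_def)
    qed
  next
    fix j v w assume vw: "v < w" "w < 8 * M" and "U' j v w"
    then show "lab j v = lab j w"
      using const[of "v mod M" "w mod M" "j - 3 * M"] mod_less[of v w] M0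
      by (auto simp: U'_def lab_def split: if_splits)
  next
    fix j a b c d
    assume lt: "a < c" "c < b" "b < d" "d < 8 * M" and U: "U' j a b" "U' j c d"
    show "lab j a \<noteq> lab j c"
    proof
      assume eq: "lab j a = lab j c"
      show False
      proof (cases "j < 3 * M")
        case True
        define p where "p = j div M"
        have p: "p < 3" using True by (simp add: p_def less_mult_imp_div_less)
        have lab: "lab j a = lab j c" "lab j c = lab j b" "lab j b = lab j d"
          using U eq True by (simp_all add: U'_def)
        have blocks: "v div M < w div M \<and> octagon_group p (v div M) = octagon_group p (w div M)"
          if "lab j v = lab j w" "v < w" for v w
        proof -
          have *: "octagon_group p (v div M) = octagon_group p (w div M)" "copy p (j mod M) v = copy p (j mod M) w"
            using that True by (simp_all add: lab_def p_def)
          have "v div M \<noteq> w div M"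
          proof
            assume eq: "v div M = w div M"
            have "[int (v mod M) - int (octagon_slope p (w div M)) * int (j mod M)
                = int (w mod M) - int (octagon_slope p (w div M)) * int (j mod M)] (mod int M)"
              using *(2) by (simp add: copy_eq_iff eq)
            then have "[int (v mod M) = int (w mod M)] (mod int M)"
              by (simp add: cong_iff_dvd_diff)
            then have "v mod M = w mod M"
              using M0 by (simp add: cong_def)
            with mod_less[OF that(2) eq] show False by simp
          qed
          then show ?thesis using * div_le_mono[of v w M] that(2) by simp
        qed
        have "d div M < 8" using lt by (simp add: less_mult_imp_div_less)
        then have "octagon_slope p (a div M) = octagon_slope p (b div M)
            \<or> octagon_slope p (c div M) = octagon_slope p (d div M)"
          using octagon_noncrossing[OF p] blocks[OF lab(1) lt(1)] blocks[OF lab(2) lt(2)] blocks[OF lab(3) lt(3)]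
          by blast
        then show False using U True by (simp add: U'_def p_def)
      next
        case False
        then have *: "a div M = b div M" "c div M = d div M" "a div M = c div M"
            "\<kappa> (j - 3 * M) (a mod M) = \<kappa> (j - 3 * M) (c mod M)"
            "U (j - 3 * M) (a mod M) (b mod M)" "U (j - 3 * M) (c mod M) (d mod M)"
          using U eq by (simp_all add: U'_def lab_def)
        with sep[of "a mod M" "c mod M" "b mod M" "d mod M" "j - 3 * M"] mod_less lt M0 show False
          by simp
      qed
    qed
  qed
qed

text \<open>
  Blowing up costs \<open>3 * M\<close> for \<open>8 * M\<close> vertices and leaves blocks of size \<open>M\<close>. In the limit this is
  \<open>3 / 7 < 4 / 9\<close> per vertex, and the slack absorbs the rounding of \<open>n / 8\<close> to an odd number
  as soon as \<open>n \<ge> 465\<close>. Smaller \<open>n\<close> go into the constant.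
\<close>

lemma union_coverable_linear: "\<exists>k. union_coverable n k \<and> 9 * k \<le> 4 * n + 9 * (465 * 465)"
proof (induction n rule: less_induct)
  case (less n)
  show ?case
  proof (cases "n < 465")
    case True
    then have "n * n \<le> 465 * 465" by (intro mult_le_mono) simp_all
    then show ?thesis using union_coverable_square by (intro exI[of _ "n * n"]) simp
  next
    case False
    define M where "M = 2 * ((n + 7) div 16) + 1"
    have "n + 7 = 16 * ((n + 7) div 16) + (n + 7) mod 16" "(n + 7) mod 16 < 16" by simp_all
    then have "n \<le> 8 * M" "8 * M \<le> n + 15" by (simp_all add: M_def)
    moreover from this False have "M < n" by simp
    then obtain k where k: "union_coverable M k" "9 * k \<le> 4 * M + 9 * (465 * 465)" using less by blast
    have "odd M" by (simp add: M_def)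
    then have "union_coverable n (3 * M + k)"
      using union_coverable_mono[OF union_coverable_blowup[OF k(1)]] \<open>n \<le> 8 * M\<close> by blast
    then show ?thesis using k(2) \<open>8 * M \<le> n + 15\<close> False by (intro exI[of _ "3 * M + k"]) simp
  qed
qed

section \<open>Page numbers of complete graphs\<close>

theorem theorem2:
  shows "\<exists>c::real. \<forall>n::nat. n \<ge> 1 \<longrightarrow>
    \<bar>real (local_page_number (complete_graph n)) - real n / 3\<bar> \<le> c \<and>
    local_page_number (complete_graph n) \<le> union_page_number (complete_graph n) \<and>
    real (union_page_number (complete_graph n)) \<le> 4 / 9 * real n + c"
  \<comment> \<open>The constant comes from the start of the recursion for the union page number; the two bounds
    on the local page number have errors 1 / 3 and 12.\<close>
proof (intro exI[of _ "465 * 465"] allI impI conjI)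
  fix n :: nat assume n: "n \<ge> 1"
  let ?l = "local_page_number (complete_graph n)" and ?u = "union_page_number (complete_graph n)"
  have "n + 2 = 3 * ((n + 2) div 3) + (n + 2) mod 3" "(n + 2) mod 3 < 3" by simp_all
  then have "n \<le> 3 * ((n + 2) div 3)" "3 * ((n + 2) div 3) \<le> n + 2" by simp_all
  moreover from this n have "int n - int ((n + 2) div 3) \<le> 2 * int ?l"
    by (intro local_page_number_complete_graph_ge) auto
  ultimately have lower: "n \<le> 3 * ?l + 1" by linarith
  define N where "N = n div 18"
  have "n = 18 * N + n mod 18" "n mod 18 < 18" by (simp_all add: N_def)
  then have N: "n \<le> 18 * (N + 1)" "18 * N \<le> n" by simp_all
  have "?l \<le> 6 * ((N + 1) + 1)"
    using N(1) by (intro local_page_number_complete_graph_le) auto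
  then have upper: "3 * ?l \<le> n + 36" using N(2) by simp
  show "\<bar>real ?l - real n / 3\<bar> \<le> 465 * 465"
    using lower upper by linarith
  show "?l \<le> ?u"
    by (rule local_page_number_le_union_page_number[OF finite_simple_graph_complete_graph])
  obtain k where k: "union_coverable n k" "9 * k \<le> 4 * n + 9 * (465 * 465)"
    using union_coverable_linear by blast
  then have "9 * ?u \<le> 4 * n + 9 * (465 * 465)"
    using union_page_number_le_of_coverable[OF k(1)] by linarith
  then show "real ?u \<le> 4 / 9 * real n + 465 * 465" by linarith
qed

end
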